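(* Let $B$ be the closed unit ball of $\mathcal{L}(^{2}\ell_{\infty}^{2}(\mathbb{R}))$. The set of extreme points of $B$ and the set of exposed points of $B$ are equal.
   Context: $\ell_\infty^2(\mathbb{R})$ is $\mathbb{R}^2$ with the sup norm. $\mathcal{L}(^{2}\ell_{\infty}^{2}(\mathbb{R}))$ is the space of all bilinear forms $T:\ell_{\infty}^{2}(\mathbb{R})\times\ell_{\infty}^{2}(\mathbb{R})\to\mathbb{R}$ with norm $\|T\|=\sup\{|T(x,y)|:\|x\|_\infty\le 1,\|y\|_\infty\le 1\}$. For a convex subset $A$ of a Banach space $E$: $x\in A$ is an extreme point of $A$ if $y,z\in A$ with $x=\frac{y+z}{2}$ implies $y=z$; $x\in A$ is an exposed point of $A$ if there is a linear functional $f\in E^{*}$ such that $f(x)=1=\|f\|$ and $f(y)<1$ for all $y\in A\setminus\{x\}$. *)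

theory Defs
  imports "HOL-Analysis.Analysis"
begin

text \<open>The library notion \<^const>\<open>extreme_point_of\<close> (no representation in an open segment) agrees on
  convex sets with the midpoint formulation.\<close>

lemma extreme_point_of_iff_midpoint:
  fixes A :: "'a::real_vector set"
  assumes "convex A"
  shows "x extreme_point_of A \<longleftrightarrow>
    x \<in> A \<and> (\<forall>y\<in>A. \<forall>z\<in>A. x = (1/2) *\<^sub>R (y + z) \<longrightarrow> y = z)"
proof
  assume L: "x extreme_point_of A"
  have "y = z" if "y \<in> A" "z \<in> A" "x = (1/2) *\<^sub>R (y + z)" for y z
  proof (rule ccontr)
    assume "y \<noteq> z"
    then have "x \<in> open_segment y z"
      using that(3) by (auto simp: in_segment scaleR_add_right intro!: exI[of _ "1/2::real"])
    then show False using L that by (auto simp: extreme_point_of_def)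
  qed
  then show "x \<in> A \<and> (\<forall>y\<in>A. \<forall>z\<in>A. x = (1/2) *\<^sub>R (y + z) \<longrightarrow> y = z)"
    using L by (auto simp: extreme_point_of_def)
next
  assume R: "x \<in> A \<and> (\<forall>y\<in>A. \<forall>z\<in>A. x = (1/2) *\<^sub>R (y + z) \<longrightarrow> y = z)"
  have False if ab: "a \<in> A" "b \<in> A" "x \<in> open_segment a b" for a b
  proof -
    obtain u where u: "a \<noteq> b" "0 < u" "u < 1" "x = (1 - u) *\<^sub>R a + u *\<^sub>R b"
      using ab(3) by (auto simp: in_segment)
    define e where "e = min u (1 - u)"
    have e: "0 < e" "e \<le> u" "e \<le> 1 - u" using u by (auto simp: e_def)
    define y where "y = (1 - (u - e)) *\<^sub>R a + (u - e) *\<^sub>R b"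
    define z where "z = (1 - (u + e)) *\<^sub>R a + (u + e) *\<^sub>R b"
    have "y \<in> A" unfolding y_def using assms ab u e by (intro convexD_alt) auto
    moreover have "z \<in> A" unfolding z_def using assms ab u e by (intro convexD_alt) auto
    moreover have "y + z = 2 *\<^sub>R x"
      unfolding y_def z_def u(4) scaleR_2 by (simp add: algebra_simps)
    then have "x = (1/2) *\<^sub>R (y + z)" by simp
    ultimately have "y = z" using R by blast
    moreover have "y - z = (e + e) *\<^sub>R (a - b)"
      unfolding y_def z_def scaleR_add_left scaleR_diff_left scaleR_diff_right by simp
    ultimately show False using u(1) e(1) by simp
  qed
  then show "x extreme_point_of A" using R by (auto simp: extreme_point_of_def)
qed

text \<open>The dual \<open>E\<^sup>*\<close> is the type of bounded linear functionals \<open>'a \<Rightarrow>\<^sub>L real\<close> with its operator norm.\<close>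

definition exposed_point_of :: "'a::real_normed_vector \<Rightarrow> 'a set \<Rightarrow> bool"
    (infixr \<open>(exposed'_point'_of)\<close> 50)
  where "x exposed_point_of A \<longleftrightarrow>
    x \<in> A \<and> (\<exists>f :: 'a \<Rightarrow>\<^sub>L real.
      blinfun_apply f x = 1 \<and> norm f = 1 \<and> (\<forall>y \<in> A - {x}. blinfun_apply f y < 1))"

text \<open>The underlying vector space of \<open>\<ell>\<^sub>\<infinity>\<^sup>2(\<real>)\<close> is \<^typ>\<open>real^2\<close>. The norm built into that type is
  Euclidean, so the sup norm is written explicitly as \<^const>\<open>infnorm\<close>. No continuity requirement
  is needed, the space being finite-dimensional.\<close>

typedef bilinear_form = "{T :: real^2 \<Rightarrow> real^2 \<Rightarrow> real. bilinear T}"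
  morphisms form_apply Bilinear_Form
  by (rule exI[of _ "\<lambda>x y. 0"]) (auto simp: bilinear_def intro!: linearI)

setup_lifting type_definition_bilinear_form

lemma bilinear_bdd_above_infnorm:
  fixes T :: "real^2 \<Rightarrow> real^2 \<Rightarrow> real"
  assumes "bilinear T"
  shows "bdd_above {\<bar>T x y\<bar> |x y. infnorm x \<le> 1 \<and> infnorm y \<le> 1}"
proof -
  obtain C where C: "C > 0" "\<And>x y. norm (T x y) \<le> C * norm x * norm y"
    using bilinear_bounded_pos[OF assms] by blast
  have "\<bar>T x y\<bar> \<le> C * sqrt 2 * sqrt 2" if "infnorm x \<le> 1" "infnorm y \<le> 1" for x y
  proof -
    have *: "norm v \<le> sqrt 2" if "infnorm v \<le> 1" for v :: "real^2"
      using order_trans[OF norm_le_infnorm[of v] mult_left_mono[OF that, of "sqrt (real DIM(real^2))"]]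
      by simp
    have "\<bar>T x y\<bar> \<le> C * norm x * norm y" using C(2)[of x y] by simp
    also have "\<dots> \<le> C * sqrt 2 * sqrt 2"
      using C(1) *[OF that(1)] *[OF that(2)] by (intro mult_mono) auto
    finally show ?thesis .
  qed
  then show ?thesis by (auto intro!: bdd_aboveI)
qed

lemma bilinear_scaleR_scaleR:
  fixes T :: "real^2 \<Rightarrow> real^2 \<Rightarrow> real"
  assumes "bilinear T"
  shows "T (a *\<^sub>R x) (b *\<^sub>R y) = a * b * T x y"
  using assms by (simp add: bilinear_lmul bilinear_rmul)

instantiation bilinear_form :: real_normed_vector
begin

lift_definition norm_bilinear_form :: "bilinear_form \<Rightarrow> real"
  is "\<lambda>T. Sup {\<bar>T x y\<bar> |x y. infnorm x \<le> 1 \<and> infnorm y \<le> 1}" .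

lift_definition zero_bilinear_form :: bilinear_form is "\<lambda>x y. 0"
  by (auto simp: bilinear_def intro!: linearI)

lift_definition plus_bilinear_form :: "bilinear_form \<Rightarrow> bilinear_form \<Rightarrow> bilinear_form"
  is "\<lambda>S T x y. S x y + T x y"
  by (auto simp: bilinear_def intro!: linear_compose_add)

lift_definition minus_bilinear_form :: "bilinear_form \<Rightarrow> bilinear_form \<Rightarrow> bilinear_form"
  is "\<lambda>S T x y. S x y - T x y"
  by (auto simp: bilinear_def intro!: linear_compose_sub)

lift_definition uminus_bilinear_form :: "bilinear_form \<Rightarrow> bilinear_form"
  is "\<lambda>T x y. - T x y"
  by (auto simp: bilinear_def intro!: linear_compose_neg)

lift_definition scaleR_bilinear_form :: "real \<Rightarrow> bilinear_form \<Rightarrow> bilinear_form"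
  is "\<lambda>c T x y. c *\<^sub>R T x y"
  by (auto simp: bilinear_def linear_iff algebra_simps)

definition dist_bilinear_form :: "bilinear_form \<Rightarrow> bilinear_form \<Rightarrow> real"
  where "dist_bilinear_form S T = norm (S - T)"

definition sgn_bilinear_form :: "bilinear_form \<Rightarrow> bilinear_form"
  where "sgn_bilinear_form T = inverse (norm T) *\<^sub>R T"

definition uniformity_bilinear_form :: "(bilinear_form \<times> bilinear_form) filter"
  where "uniformity_bilinear_form = (INF e\<in>{0 <..}. principal {(S, T). dist S T < e})"

definition open_bilinear_form :: "bilinear_form set \<Rightarrow> bool"
  where "open_bilinear_form U = (\<forall>S\<in>U. \<forall>\<^sub>F (S', T) in uniformity. S' = S \<longrightarrow> T \<in> U)"

lemma abs_form_apply_le_norm: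
  assumes "infnorm x \<le> 1" "infnorm y \<le> 1"
  shows "\<bar>form_apply T x y\<bar> \<le> norm T"
  using assms by transfer (auto intro!: cSup_upper bilinear_bdd_above_infnorm)

lemma norm_bilinear_form_le:
  assumes "\<And>x y. infnorm x \<le> 1 \<Longrightarrow> infnorm y \<le> 1 \<Longrightarrow> \<bar>form_apply T x y\<bar> \<le> C"
  shows "norm T \<le> C"
  unfolding norm_bilinear_form.rep_eq
proof (rule cSup_least)
  show "{\<bar>form_apply T x y\<bar> |x y. infnorm x \<le> 1 \<and> infnorm y \<le> 1} \<noteq> {}"
    using infnorm_0[where 'a="real^2"] zero_le_one[where 'a=real] by (metis (mono_tags, lifting) empty_Collect_eq)
qed (use assms in auto)

lemma norm_scaleR_bilinear_form_le:
  fixes T :: bilinear_form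
  shows "norm (c *\<^sub>R T) \<le> \<bar>c\<bar> * norm T"
  by (rule norm_bilinear_form_le)
     (auto simp: scaleR_bilinear_form.rep_eq abs_mult intro!: mult_left_mono abs_form_apply_le_norm)

lemma norm_bilinear_form_eq_0:
  fixes T :: bilinear_form
  shows "norm T = 0 \<longleftrightarrow> T = 0"
proof
  assume n: "norm T = 0"
  have "form_apply T x y = 0" for x y
  proof -
    have bil: "bilinear (form_apply T)" using form_apply by auto
    have scale: "infnorm ((1 / (1 + infnorm v)) *\<^sub>R v) \<le> 1" for v :: "real^2"
      using infnorm_pos_le[of v] by (simp add: infnorm_mul field_simps)
    have "\<bar>form_apply T ((1 / (1 + infnorm x)) *\<^sub>R x) ((1 / (1 + infnorm y)) *\<^sub>R y)\<bar> \<le> 0"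
      using abs_form_apply_le_norm[OF scale[of x] scale[of y], of T] n by simp
    moreover have "1 + infnorm x > 0" "1 + infnorm y > 0"
      using infnorm_pos_le[of x] infnorm_pos_le[of y] by linarith+
    ultimately show ?thesis by (simp add: bilinear_scaleR_scaleR[OF bil] divide_le_0_iff mult_le_0_iff)
  qed
  then show "T = 0" by transfer auto
next
  assume "T = 0"
  then have "norm T \<le> 0" by (auto intro!: norm_bilinear_form_le simp: zero_bilinear_form.rep_eq)
  moreover have "0 \<le> norm T"
    using abs_form_apply_le_norm[of 0 0 T] by (simp add: infnorm_0)
  ultimately show "norm T = 0" by simp
qed

instance
proof
  fix S T U :: bilinear_form and a b :: real
  show "S + T + U = S + (T + U)" "S + T = T + S" "0 + S = S" "- S + S = 0" "S - T = S + - T"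
    by (transfer, simp add: fun_eq_iff algebra_simps)+
  show "a *\<^sub>R (S + T) = a *\<^sub>R S + a *\<^sub>R T" "(a + b) *\<^sub>R S = a *\<^sub>R S + b *\<^sub>R S"
    "a *\<^sub>R b *\<^sub>R S = (a * b) *\<^sub>R S" "1 *\<^sub>R S = S"
    by (transfer, simp add: fun_eq_iff algebra_simps)+
  show "dist S T = norm (S - T)" by (rule dist_bilinear_form_def)
  show "sgn S = inverse (norm S) *\<^sub>R S" by (rule sgn_bilinear_form_def)
  show "uniformity = (INF e\<in>{0 <..}. principal {(S, T :: bilinear_form). dist S T < e})"
    by (rule uniformity_bilinear_form_def)
  show "open W = (\<forall>S\<in>W. \<forall>\<^sub>F (S', T) in uniformity. S' = S \<longrightarrow> T \<in> W)"
    for W :: "bilinear_form set"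
    by (rule open_bilinear_form_def)
  show "norm S = 0 \<longleftrightarrow> S = 0" by (rule norm_bilinear_form_eq_0)
  show "norm (S + T) \<le> norm S + norm T"
  proof (rule norm_bilinear_form_le)
    fix x y :: "real^2" assume "infnorm x \<le> 1" "infnorm y \<le> 1"
    then show "\<bar>form_apply (S + T) x y\<bar> \<le> norm S + norm T"
      using abs_form_apply_le_norm[of x y S] abs_form_apply_le_norm[of x y T]
      by (simp add: plus_bilinear_form.rep_eq)
  qed
  show "norm (a *\<^sub>R S) = \<bar>a\<bar> * norm S"
  proof (cases "a = 0")
    case True
    then have "a *\<^sub>R S = 0" by transfer simp
    then show ?thesis using True norm_bilinear_form_eq_0[of "a *\<^sub>R S"] by simp
  next
    case False
    have "inverse a *\<^sub>R a *\<^sub>R S = S" using False by transfer (simp add: fun_eq_iff)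
    then have "norm S \<le> \<bar>inverse a\<bar> * norm (a *\<^sub>R S)"
      using norm_scaleR_bilinear_form_le[of "inverse a" "a *\<^sub>R S"] by simp
    then have "\<bar>a\<bar> * norm S \<le> norm (a *\<^sub>R S)" using False by (simp add: field_simps)
    then show ?thesis using norm_scaleR_bilinear_form_le[of a S] by simp
  qed
qed

end

end

theory Submission
  imports Defs
begin

text \<open>The vertices of the unit square of \<open>\<ell>\<^sub>\<infinity>\<^sup>2(\<real>)\<close> are, up to sign, \<open>(1, 1)\<close> and \<open>(1, -1)\<close>, and they form
  an orthogonal basis of the plane. A bilinear form is therefore determined by its four values at
  pairs of these vertices, and its norm is the largest of their absolute values: the space of
  forms is isometric to \<open>\<ell>\<^sub>\<infinity>\<^sup>4(\<real>)\<close>. At an extreme point \<open>T\<close> of the ball all four values are \<open>\<plusminus>1\<close>, and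
  then \<open>T\<close> is exposed by the functional that averages the four values with the signs of \<open>T\<close>.\<close>

text \<open>If \<open>x\<close> is the midpoint of \<open>y\<close> and \<open>z\<close>, the values
  of \<open>f\<close> at \<open>y\<close> and \<open>z\<close> are at most 1 and average to 1. Both
  are then 1, a value that \<open>f\<close> takes on \<open>A\<close> only at
  \<open>x\<close>.\<close>

lemma exposed_point_of_imp_extreme_point_of:
  assumes "convex A" and "x exposed_point_of A"
  shows "x extreme_point_of A"
proof -
  obtain f :: "'a \<Rightarrow>\<^sub>L real" where x: "x \<in> A" "blinfun_apply f x = 1"
    and f: "\<And>y. y \<in> A \<Longrightarrow> y \<noteq> x \<Longrightarrow> blinfun_apply f y < 1"
    using assms(2) by (auto simp: exposed_point_of_def)
  have "y = z" if yz: "y \<in> A" "z \<in> A" and mid: "x = (1/2) *\<^sub>R (y + z)" for y z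
  proof -
    have "blinfun_apply f x = (blinfun_apply f y + blinfun_apply f z) / 2"
      unfolding mid by (simp add: blinfun.add_right blinfun.scaleR_right)
    then have sum: "blinfun_apply f y + blinfun_apply f z = 2"
      using x(2) by simp
    have "blinfun_apply f y \<le> 1" "blinfun_apply f z \<le> 1"
      using f yz x(2) by (metis less_eq_real_def)+
    then have "\<not> blinfun_apply f y < 1" "\<not> blinfun_apply f z < 1"
      using sum by linarith+
    then show "y = z"
      using f yz by blast
  qed
  then show ?thesis
    using x(1) by (simp add: extreme_point_of_iff_midpoint[OF assms(1)])
qed

definition vertex :: "bool \<Rightarrow> real^2"
  where "vertex s = vector [1, if s then 1 else -1]"

text \<open>The basis dual to the two vertices; 2 is the squared Euclidean length of a
  vertex.\<close>

definition vertex_coord :: "bool \<Rightarrow> real^2 \<Rightarrow> real"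
  where "vertex_coord s x = (x \<bullet> vertex s) / 2"

lemma infnorm_vertex: "infnorm (vertex s) \<le> 1"
  by (simp add: infnorm_2 vertex_def)

lemma vertex_coord_vertex: "vertex_coord s (vertex t) = of_bool (s = t)"
  by (cases s; cases t) (simp_all add: vertex_coord_def vertex_def inner_vec_def sum_2)

lemma vertex_coord_expansion: "x = (\<Sum>s\<in>UNIV. vertex_coord s x *\<^sub>R vertex s)"
  by (simp add: vec_eq_iff forall_2 vertex_coord_def vertex_def inner_vec_def sum_2 UNIV_bool
      field_simps)

text \<open>For x = (a, b) the coordinates are (a + b)/2 and (a - b)/2, and |a + b| + |a - b| = 2
  max(|a|, |b|).\<close>

lemma sum_abs_vertex_coord_le_infnorm: "(\<Sum>s\<in>UNIV. \<bar>vertex_coord s x\<bar>) \<le> infnorm x"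
  by (simp add: infnorm_2 vertex_coord_def vertex_def inner_vec_def sum_2 UNIV_bool) argo

abbreviation vertex_value :: "bilinear_form \<Rightarrow> bool \<Rightarrow> bool \<Rightarrow> real"
  where "vertex_value T s t \<equiv> form_apply T (vertex s) (vertex t)"

lemma abs_vertex_value_le_norm: "\<bar>vertex_value T s t\<bar> \<le> norm T"
  by (intro abs_form_apply_le_norm infnorm_vertex)

lemma form_apply_vertex_expansion:
  "form_apply T x y =
    (\<Sum>s\<in>UNIV. \<Sum>t\<in>UNIV. vertex_coord s x * vertex_coord t y * vertex_value T s t)"
proof -
  have bil: "bilinear (form_apply T)"
    using form_apply by auto
  have "form_apply T x y = form_apply T (\<Sum>s\<in>UNIV. vertex_coord s x *\<^sub>R vertex s)
      (\<Sum>t\<in>UNIV. vertex_coord t y *\<^sub>R vertex t)"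
    by (rule arg_cong2[where f = "form_apply T", OF vertex_coord_expansion vertex_coord_expansion])
  also have "\<dots> = (\<Sum>s\<in>UNIV. \<Sum>t\<in>UNIV.
      vertex_coord s x * vertex_coord t y * vertex_value T s t)"
    by (simp add: bilinear_sum[OF bil] sum.cartesian_product bilinear_scaleR_scaleR[OF bil])
  finally show ?thesis .
qed

lemma bilinear_form_eqI:
  assumes "\<And>s t. vertex_value S s t = vertex_value T s t"
  shows "S = T"
proof -
  have "form_apply S x y = form_apply T x y" for x y
    unfolding form_apply_vertex_expansion[of _ x y] assms ..
  then show ?thesis
    by (simp add: form_apply_inject[symmetric] fun_eq_iff)
qed

text \<open>On the unit ball \<open>form_apply T x y\<close> is a combination of the vertex values
  whose coefficients have absolute values summing to at most 1. With
  \<open>abs_vertex_value_le_norm\<close> this gives the isometry with the sup norm on four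
  values.\<close>

lemma norm_bilinear_form_le_vertex:
  assumes "\<And>s t. \<bar>vertex_value T s t\<bar> \<le> C"
  shows "norm T \<le> C"
proof (rule norm_bilinear_form_le)
  fix x y :: "real^2"
  assume xy: "infnorm x \<le> 1" "infnorm y \<le> 1"
  have C: "0 \<le> C"
    using assms[of True True] by linarith
  have "\<bar>form_apply T x y\<bar> \<le>
      (\<Sum>s\<in>UNIV. \<Sum>t\<in>UNIV. \<bar>vertex_coord s x * vertex_coord t y * vertex_value T s t\<bar>)"
    unfolding form_apply_vertex_expansion[of _ x y]
    by (intro order_trans[OF sum_abs] sum_mono order_refl)
  also have "\<dots> \<le> (\<Sum>s\<in>UNIV. \<Sum>t\<in>UNIV. \<bar>vertex_coord s x\<bar> * \<bar>vertex_coord t y\<bar> * C)"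
    by (intro sum_mono) (simp add: abs_mult mult_left_mono assms)
  also have "\<dots> = (\<Sum>s\<in>UNIV. \<bar>vertex_coord s x\<bar>) * (\<Sum>t\<in>UNIV. \<bar>vertex_coord t y\<bar>) * C"
    by (simp add: UNIV_bool algebra_simps)
  also have "\<dots> \<le> 1 * 1 * C"
    using xy sum_abs_vertex_coord_le_infnorm[of x] sum_abs_vertex_coord_le_infnorm[of y] C
    by (intro mult_mono) (auto intro: sum_nonneg)
  finally show "\<bar>form_apply T x y\<bar> \<le> C"
    by simp
qed

text \<open>Adding a multiple of this form changes a single vertex value.\<close>

lift_definition vertex_form :: "bool \<Rightarrow> bool \<Rightarrow> bilinear_form"
  is "\<lambda>s t x y. vertex_coord s x * vertex_coord t y"
  by (auto simp: bilinear_def vertex_coord_def inner_left_distrib algebra_simps add_divide_distrib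
      intro!: linearI)

lemma vertex_value_vertex_form:
  "vertex_value (vertex_form s t) s' t' = of_bool (s = s' \<and> t = t')"
  by (simp add: vertex_form.rep_eq vertex_coord_vertex)

text \<open>A vertex value strictly inside [-1, 1] could be moved both up and down within the ball,
  making \<open>T\<close> the midpoint of two distinct points.\<close>

lemma extreme_point_vertex_value:
  assumes "T extreme_point_of cball 0 1"
  shows "\<bar>vertex_value T s t\<bar> = 1"
proof (rule ccontr)
  assume neq: "\<bar>vertex_value T s t\<bar> \<noteq> 1"
  have T: "norm T \<le> 1"
    using assms by (simp add: extreme_point_of_def)
  \<comment> \<open>The slack at \<open>(s, t)\<close>: a shift of this value by at most
    \<open>e\<close> keeps it in [-1, 1].\<close>
  define e where "e = 1 - \<bar>vertex_value T s t\<bar>"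
  have e: "e > 0"
    using neq abs_vertex_value_le_norm[of T s t] T by (simp add: e_def)
  have ball: "norm (T + c *\<^sub>R vertex_form s t) \<le> 1" if c: "\<bar>c\<bar> \<le> e" for c
  proof (rule norm_bilinear_form_le_vertex)
    fix s' t'
    show "\<bar>vertex_value (T + c *\<^sub>R vertex_form s t) s' t'\<bar> \<le> 1"
      using c abs_vertex_value_le_norm[of T s' t'] T
      by (auto simp: plus_bilinear_form.rep_eq scaleR_bilinear_form.rep_eq vertex_value_vertex_form
          e_def)
  qed
  have mid: "T = (1/2) *\<^sub>R ((T + e *\<^sub>R vertex_form s t) + (T + (- e) *\<^sub>R vertex_form s t))"
    by (simp add: scaleR_add_right scaleR_add_left[symmetric])
  have "T + e *\<^sub>R vertex_form s t = T + (- e) *\<^sub>R vertex_form s t"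
    using assms mid ball[of e] ball[of "- e"] e
    unfolding extreme_point_of_iff_midpoint[OF convex_cball] by simp
  then have "e *\<^sub>R vertex_form s t = (- e) *\<^sub>R vertex_form s t"
    by (rule add_left_imp_eq)
  then have "vertex_value (e *\<^sub>R vertex_form s t) s t = vertex_value ((- e) *\<^sub>R vertex_form s t) s t"
    by simp
  then show False
    using e
    by (simp add: scaleR_bilinear_form.rep_eq uminus_bilinear_form.rep_eq vertex_value_vertex_form)
qed

text \<open>On the ball each of the four signed values is at most 1, so their average reaches 1 only
  when all of them equal 1, which determines the form.\<close>

lemma exposed_point_of_unit_ball_if_vertex_values:
  assumes T: "\<And>s t. \<bar>vertex_value T s t\<bar> = 1"
  shows "T exposed_point_of cball 0 1"
proof -
  \<comment> \<open>The values of \<open>T\<close> are their own signs; dividing by 4 normalises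
    \<open>g T\<close> to 1.\<close>
  define g where "g S = (\<Sum>s\<in>UNIV. \<Sum>t\<in>UNIV. vertex_value T s t * vertex_value S s t) / 4" for S
  have summand_le: "\<bar>vertex_value T s t * vertex_value S s t\<bar> \<le> norm S" for S s t
    by (simp add: abs_mult T abs_vertex_value_le_norm)
  have g_le: "\<bar>g S\<bar> \<le> norm S" for S
    using summand_le[of True True S] summand_le[of True False S]
      summand_le[of False True S] summand_le[of False False S]
    by (simp add: g_def UNIV_bool)
  have "bounded_linear g"
  proof (rule bounded_linear_intro[where K = 1])
    show "g (S + S') = g S + g S'" for S S'
      by (simp add: g_def plus_bilinear_form.rep_eq UNIV_bool algebra_simps add_divide_distrib)
    show "g (c *\<^sub>R S) = c *\<^sub>R g S" for c S
      by (simp add: g_def scaleR_bilinear_form.rep_eq UNIV_bool algebra_simps add_divide_distrib)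
    show "norm (g S) \<le> norm S * 1" for S
      using g_le by simp
  qed
  then have f: "blinfun_apply (Blinfun g) = g"
    by (rule bounded_linear_Blinfun_apply)
  have sq: "vertex_value T s t * vertex_value T s t = 1" for s t
    using T[of s t] by (metis abs_mult_self_eq mult_1)
  have gT: "g T = 1"
    by (simp add: g_def sq)
  have nT: "norm T \<le> 1"
    by (rule norm_bilinear_form_le_vertex) (simp add: T)
  have "norm (Blinfun g) \<le> 1"
    by (rule norm_blinfun_bound) (simp_all add: f g_le)
  \<comment> \<open>The norm is attained at \<open>T\<close>, which lies in the ball.\<close>
  moreover have "1 \<le> norm (Blinfun g)"
  proof -
    have "1 \<le> norm (Blinfun g) * norm T"
      using norm_blinfun[of "Blinfun g" T] by (simp add: f gT)
    also have "\<dots> \<le> norm (Blinfun g)"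
      using nT by (simp add: mult_left_le)
    finally show ?thesis .
  qed
  ultimately have nf: "norm (Blinfun g) = 1"
    by simp
  have lt: "g S < 1" if S: "norm S \<le> 1" "S \<noteq> T" for S
  proof (rule ccontr)
    assume "\<not> g S < 1"
    then have sum: "(\<Sum>s\<in>UNIV. \<Sum>t\<in>UNIV. vertex_value T s t * vertex_value S s t) \<ge> 4"
      by (simp add: g_def)
    have le: "vertex_value T s t * vertex_value S s t \<le> 1" for s t
      using summand_le[of s t S] S(1) by linarith
    \<comment> \<open>Four numbers that are at most 1 and sum to at least 4 are all 1.\<close>
    have one: "vertex_value T s t * vertex_value S s t = 1" for s t
      using sum le[of True True] le[of True False] le[of False True] le[of False False]
      by (cases s; cases t) (simp_all add: UNIV_bool)
    have "vertex_value S s t = vertex_value T s t" for s t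
      using one[of s t] sq[of s t] by (metis mult_left_cancel mult_zero_left zero_neq_one)
    then show False
      using bilinear_form_eqI S(2) by blast
  qed
  show ?thesis
    unfolding exposed_point_of_def
    by (intro conjI exI[of _ "Blinfun g"] ballI) (use nT nf gT lt in \<open>auto simp: f\<close>)
qed

theorem theorem3p2:
  fixes B :: "bilinear_form set"
  assumes "B = cball 0 1"
  shows "{T. T extreme_point_of B} = {T. T exposed_point_of B}"
  unfolding assms
  using extreme_point_vertex_value exposed_point_of_unit_ball_if_vertex_values
    exposed_point_of_imp_extreme_point_of[OF convex_cball]
  by blast

end
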